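(* Let $A^{(1)},\dots,A^{(K)}\in\mathbb{R}^{n\times n}$ be symmetric matrices, let $\boldsymbol{p}_k=[\underline{p}_k,\overline{p}_k]$, $k=1,\dots,K$, be compact real intervals, and let $\boldsymbol{p}=\boldsymbol{p}_1\times\dots\times\boldsymbol{p}_K$. For $p\in\mathbb{R}^K$ let $A(p)=\sum_{k=1}^K A^{(k)}p_k$. For each $k=1,\dots,K$, let $A^{(k)}=A^{(k)}_1-A^{(k)}_2$, where both $A^{(k)}_1,A^{(k)}_2\in\mathbb{R}^{n\times n}$ are positive semidefinite. If the parametric matrix $A(p)$, $p\in\boldsymbol{p}$, is weakly positive definite, then the matrix $$\sum_{k=1}^K\left(A^{(k)}_1\overline{p}_k-A^{(k)}_2\underline{p}_k\right)$$ is positive definite.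
   Context: The parametric matrix $A(p)$, $p\in\boldsymbol{p}$, is called weakly positive definite if $A(p)$ is positive definite for at least one $p\in\boldsymbol{p}$. Intervals satisfy $\underline{p}_k\le\overline{p}_k$. Positive (semi)definite refers to real symmetric matrices. *)

theory Defs
  imports "HOL-Analysis.Analysis"
begin

definition symmetric_matrix :: "real ^ 'n ^ 'n \<Rightarrow> bool" where
  "symmetric_matrix M \<longleftrightarrow> transpose M = M"

definition positive_semidefinite :: "real ^ 'n ^ 'n \<Rightarrow> bool" where
  "positive_semidefinite M \<longleftrightarrow> symmetric_matrix M \<and> (\<forall>x. x \<bullet> (M *v x) \<ge> 0)"

definition positive_definite :: "real ^ 'n ^ 'n \<Rightarrow> bool" where
  "positive_definite M \<longleftrightarrow> symmetric_matrix M \<and> (\<forall>x. x \<noteq> 0 \<longrightarrow> x \<bullet> (M *v x) > 0)"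

(* The finite index type 'k plays the role of {1, ..., K}. *)
definition parametric_matrix :: "('k::finite \<Rightarrow> real ^ 'n ^ 'n) \<Rightarrow> real ^ 'k \<Rightarrow> real ^ 'n ^ 'n" where
  "parametric_matrix A p = (\<Sum>k\<in>UNIV. (p $ k) *\<^sub>R A k)"

definition weakly_positive_definite :: "(real ^ 'k \<Rightarrow> real ^ 'n ^ 'n) \<Rightarrow> (real ^ 'k) set \<Rightarrow> bool" where
  "weakly_positive_definite M P \<longleftrightarrow> (\<exists>p\<in>P. positive_definite (M p))"

end

theory Submission
  imports Defs
begin

text \<open>
  Fix a parameter \<open>p\<close> in the box for which \<open>A(p)\<close> is positive definite. Splitting each
  \<open>A k\<close> as \<open>A1 k - A2 k\<close> and comparing coefficients gives
  \[
    \sum_k (\overline{p}_k A_1^{(k)} - \underline{p}_k A_2^{(k)})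
      = A(p) + \sum_k ((\overline{p}_k - p_k) A_1^{(k)} + (p_k - \underline{p}_k) A_2^{(k)}).
  \]
  Since \<open>p\<close> lies in the box, the coefficients in the last sum are nonnegative, so that sum is
  positive semidefinite, because the positive semidefinite matrices form a convex cone.
  Adding a positive semidefinite matrix preserves positive definiteness.
\<close>

lemma symmetric_matrix_add:
  "symmetric_matrix M \<Longrightarrow> symmetric_matrix N \<Longrightarrow> symmetric_matrix (M + N)"
  by (simp add: symmetric_matrix_def transpose_def vec_eq_iff)

lemma symmetric_matrix_scaleR: "symmetric_matrix M \<Longrightarrow> symmetric_matrix (c *\<^sub>R M)"
  by (simp add: symmetric_matrix_def transpose_def vec_eq_iff)

lemma positive_semidefinite_0: "positive_semidefinite 0"
  by (simp add: positive_semidefinite_def symmetric_matrix_def transpose_def vec_eq_iff)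

lemma positive_semidefinite_add:
  "positive_semidefinite M \<Longrightarrow> positive_semidefinite N \<Longrightarrow> positive_semidefinite (M + N)"
  by (simp add: positive_semidefinite_def symmetric_matrix_add
      matrix_vector_mult_add_rdistrib inner_add_right)

lemma positive_semidefinite_scaleR:
  "0 \<le> c \<Longrightarrow> positive_semidefinite M \<Longrightarrow> positive_semidefinite (c *\<^sub>R M)"
  by (simp add: positive_semidefinite_def symmetric_matrix_scaleR
      flip: scaleR_matrix_vector_assoc)

lemma positive_semidefinite_sum:
  "(\<And>i. i \<in> I \<Longrightarrow> positive_semidefinite (M i)) \<Longrightarrow> positive_semidefinite (\<Sum>i\<in>I. M i)"
  by (induction I rule: infinite_finite_induct)
    (simp_all add: positive_semidefinite_0 positive_semidefinite_add)

lemma positive_definite_add_semidefinite: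
  "positive_definite M \<Longrightarrow> positive_semidefinite N \<Longrightarrow> positive_definite (M + N)"
  by (simp add: positive_definite_def positive_semidefinite_def symmetric_matrix_add
      matrix_vector_mult_add_rdistrib inner_add_right add_pos_nonneg)

theorem theorem11:
  fixes A A1 A2 :: "'k::finite \<Rightarrow> real ^ 'n ^ 'n"
    and p_lo p_hi :: "real ^ 'k"
  assumes "\<And>k. symmetric_matrix (A k)"
    and "\<And>k. p_lo $ k \<le> p_hi $ k"
    and "\<And>k. A k = A1 k - A2 k"
    and "\<And>k. positive_semidefinite (A1 k)"
    and "\<And>k. positive_semidefinite (A2 k)"
    and "weakly_positive_definite (parametric_matrix A) {p. \<forall>k. p $ k \<in> {p_lo $ k .. p_hi $ k}}"
  shows "positive_definite (\<Sum>k\<in>UNIV. (p_hi $ k) *\<^sub>R A1 k - (p_lo $ k) *\<^sub>R A2 k)"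
proof -
  obtain p where box: "\<And>k. p_lo $ k \<le> p $ k" "\<And>k. p $ k \<le> p_hi $ k"
    and pd: "positive_definite (parametric_matrix A p)"
    using assms(6) by (auto simp: weakly_positive_definite_def)
  define E where
    "E = (\<Sum>k\<in>UNIV. (p_hi $ k - p $ k) *\<^sub>R A1 k + (p $ k - p_lo $ k) *\<^sub>R A2 k)"
  have "positive_semidefinite E"
    unfolding E_def using box assms(4,5)
    by (intro positive_semidefinite_sum positive_semidefinite_add positive_semidefinite_scaleR)
      auto
  with pd have "positive_definite (parametric_matrix A p + E)"
    by (rule positive_definite_add_semidefinite)
  also have "parametric_matrix A p + E =
      (\<Sum>k\<in>UNIV. (p_hi $ k) *\<^sub>R A1 k - (p_lo $ k) *\<^sub>R A2 k)"
    unfolding parametric_matrix_def E_def assms(3) sum.distrib[symmetric]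
    by (intro sum.cong) (simp_all add: algebra_simps)
  finally show ?thesis .
qed

end
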